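(* For any positive integer $n$: (a) $m(n) \geq 2\sqrt{\binom{n}{2}}$; (b) $m^*(n) = \binom{n}{2}$; moreover, for a bi-coloured system $\mathcal{S} = (V,f)$ one has $m^*_{\mathcal{S}} = \binom{|V|}{2}$ if and only if the hypergraph $\mathcal{H}_{\mathcal{S}}$ is the complete 3-uniform hypergraph on $V$ (i.e. $\mathcal{H}_{\mathcal{S}} = \binom{V}{3}$) or the empty hypergraph (i.e. $\mathcal{H}_{\mathcal{S}} = \emptyset$).
   Context: For a set $V$, $\binom{V}{k}$ denotes the family of $k$-element subsets of $V$. A bi-coloured system is a pair $\mathcal{S} = (V,f)$ where $V$ is a finite (nonempty) set of points and $f : \binom{V}{3} \to \{R,B\}$ is any function (colouring each triple red, $R$, or blue, $B$). For $\{u,v\} \in \binom{V}{2}$, the red line and blue line generated by $u,v$ are $$R_{\mathcal{S}}(uv) = \{u,v\} \cup \{p : f(\{u,v,p\}) = R\}, \qquad B_{\mathcal{S}}(uv) = \{u,v\} \cup \{p : f(\{u,v,p\}) = B\}.$$ Let $m_{\mathcal{S}}(R)$ be the number of distinct sets of the form $R_{\mathcal{S}}(uv)$ and $m_{\mathcal{S}}(B)$ the number of distinct sets of the form $B_{\mathcal{S}}(uv)$, over all $\{u,v\}\in\binom{V}{2}$. Put $m_{\mathcal{S}} = m_{\mathcal{S}}(R) + m_{\mathcal{S}}(B)$ (red and blue lines are counted separately, even if a red line and a blue line are equal as sets) and $m^*_{\mathcal{S}} = m_{\mathcal{S}}(R)\, m_{\mathcal{S}}(B)$. The hypergraph of red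 triples is $\mathcal{H}_{\mathcal{S}} = \{ T \in \binom{V}{3} : f(T) = R\}$. Finally, $m(n)$ (resp. $m^*(n)$) is the minimum of $m_{\mathcal{S}}$ (resp. $m^*_{\mathcal{S}}$) over all bi-coloured systems $\mathcal{S}=(V,f)$ with $|V| = n$. *)

theory Defs
  imports Complex_Main "HOL-Library.Ramsey"
begin

text \<open>
  A bi-coloured system is given by a finite nonempty set \<open>V\<close> and a function \<open>f\<close> on
  sets. Only the values of \<open>f\<close> on the triples of \<open>V\<close>, i.e.\ on \<^term>\<open>nsets V 3\<close>, are ever
  used, so a total \<open>f\<close> stands for its restriction to the triples.
\<close>

datatype colour = Red | Blue

definition line :: "'a set \<Rightarrow> ('a set \<Rightarrow> colour) \<Rightarrow> colour \<Rightarrow> 'a \<Rightarrow> 'a \<Rightarrow> 'a set" where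
  "line V f c u v = {u, v} \<union> {p. {u, v, p} \<in> nsets V 3 \<and> f {u, v, p} = c}"

definition lines :: "'a set \<Rightarrow> ('a set \<Rightarrow> colour) \<Rightarrow> colour \<Rightarrow> 'a set set" where
  "lines V f c = {line V f c u v | u v. {u, v} \<in> nsets V 2}"

definition num_lines :: "'a set \<Rightarrow> ('a set \<Rightarrow> colour) \<Rightarrow> nat" where
  "num_lines V f = card (lines V f Red) + card (lines V f Blue)"

definition prod_lines :: "'a set \<Rightarrow> ('a set \<Rightarrow> colour) \<Rightarrow> nat" where
  "prod_lines V f = card (lines V f Red) * card (lines V f Blue)"

definition red_triples :: "'a set \<Rightarrow> ('a set \<Rightarrow> colour) \<Rightarrow> 'a set set" where
  "red_triples V f = {T \<in> nsets V 3. f T = Red}"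

text \<open>
  The minima range over systems whose points are natural numbers. This is no restriction:
  the lemmas \<open>min_num_lines_le\<close> and \<open>min_prod_lines_le\<close> below bound the systems over
  an arbitrary type, and the minima are attained for every positive \<open>n\<close>.
\<close>

definition min_num_lines :: "nat \<Rightarrow> nat" where
  "min_num_lines n =
    (LEAST k. \<exists>(V :: nat set) f. finite V \<and> V \<noteq> {} \<and> card V = n \<and> num_lines V f = k)"

definition min_prod_lines :: "nat \<Rightarrow> nat" where
  "min_prod_lines n =
    (LEAST k. \<exists>(V :: nat set) f. finite V \<and> V \<noteq> {} \<and> card V = n \<and> prod_lines V f = k)"

lemma min_num_lines_attained:
  assumes "n \<ge> 1"
  shows "\<exists>(V :: nat set) f. finite V \<and> V \<noteq> {} \<and> card V = n \<and> num_lines V f = min_num_lines n"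
proof -
  have "\<exists>k. \<exists>(V :: nat set) f. finite V \<and> V \<noteq> {} \<and> card V = n \<and> num_lines V f = k"
    using assms by (intro exI[of _ "num_lines {..<n} undefined"] exI[of _ "{..<n}"]) (auto simp: lessThan_empty_iff)
  from LeastI_ex[OF this] show ?thesis
    unfolding min_num_lines_def .
qed

lemma min_prod_lines_attained:
  assumes "n \<ge> 1"
  shows "\<exists>(V :: nat set) f. finite V \<and> V \<noteq> {} \<and> card V = n \<and> prod_lines V f = min_prod_lines n"
proof -
  have "\<exists>k. \<exists>(V :: nat set) f. finite V \<and> V \<noteq> {} \<and> card V = n \<and> prod_lines V f = k"
    using assms by (intro exI[of _ "prod_lines {..<n} undefined"] exI[of _ "{..<n}"]) (auto simp: lessThan_empty_iff)
  from LeastI_ex[OF this] show ?thesis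
    unfolding min_prod_lines_def .
qed

lemma card_lines_image:
  fixes g :: "'a \<Rightarrow> 'b"
  assumes g: "inj_on g V"
  shows "card (lines (g ` V) (\<lambda>T. f (inv_into V g ` T)) c) = card (lines V f c)"
proof -
  let ?f = "\<lambda>T. f (inv_into V g ` T)"
  have ns: "g ` T \<in> nsets (g ` V) k \<longleftrightarrow> T \<in> nsets V k" if "T \<subseteq> V" for T k
    using that inj_on_subset[OF g that]
    by (auto simp: nsets_def card_image dest: finite_imageD)
  have ff: "?f (g ` T) = f T" if "T \<subseteq> V" for T
    using that g by (simp add: inv_into_image_cancel)
  have line: "line (g ` V) ?f c (g u) (g v) = g ` line V f c u v" if "u \<in> V" "v \<in> V" for u v
  proof -
    have eq: "{g u, g v, g p} \<in> nsets (g ` V) 3 \<and> ?f {g u, g v, g p} = c \<longleftrightarrow>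
        {u, v, p} \<in> nsets V 3 \<and> f {u, v, p} = c" if "p \<in> V" for p
      using ns[of "{u, v, p}" 3] ff[of "{u, v, p}"] that \<open>u \<in> V\<close> \<open>v \<in> V\<close> by simp
    have "{q. {g u, g v, q} \<in> nsets (g ` V) 3 \<and> ?f {g u, g v, q} = c} =
        g ` {p. {u, v, p} \<in> nsets V 3 \<and> f {u, v, p} = c}" (is "?L = ?R")
    proof
      show "?L \<subseteq> ?R"
      proof
        fix q assume q: "q \<in> ?L"
        then have "q \<in> g ` V" by (auto simp: nsets_def)
        then obtain p where "p \<in> V" "q = g p" by auto
        with q eq[of p] show "q \<in> ?R" by blast
      qed
      show "?R \<subseteq> ?L"
      proof
        fix q assume "q \<in> ?R"
        then obtain p where p: "q = g p" "{u, v, p} \<in> nsets V 3" "f {u, v, p} = c" by auto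
        then have "p \<in> V" by (auto simp: nsets_def)
        with p eq[of p] show "q \<in> ?L" by blast
      qed
    qed
    then show ?thesis by (simp add: line_def image_Un)
  qed
  have "lines (g ` V) ?f c = (`) g ` lines V f c" (is "?L = ?R")
  proof
    show "?L \<subseteq> ?R"
    proof
      fix l assume "l \<in> ?L"
      then obtain x y where l: "l = line (g ` V) ?f c x y" and xy: "{x, y} \<in> nsets (g ` V) 2"
        by (auto simp: lines_def)
      from xy obtain u v where uv: "u \<in> V" "v \<in> V" "x = g u" "y = g v"
        by (auto simp: nsets_def)
      then have "{u, v} \<in> nsets V 2" using ns[of "{u, v}" 2] xy by simp
      then show "l \<in> ?R" using l line uv unfolding lines_def by blast
    qed
    show "?R \<subseteq> ?L"
    proof
      fix l assume "l \<in> ?R"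
      then obtain u v where l: "l = g ` line V f c u v" and uv: "{u, v} \<in> nsets V 2"
        by (auto simp: lines_def)
      then have V: "u \<in> V" "v \<in> V" by (auto simp: nsets_def)
      then have "{g u, g v} \<in> nsets (g ` V) 2" using ns[of "{u, v}" 2] uv by simp
      then show "l \<in> ?L" using l line[OF V] unfolding lines_def by blast
    qed
  qed
  moreover have "inj_on ((`) g) (lines V f c)"
  proof (rule inj_on_subset[OF inj_on_image_Pow[OF g]])
    show "lines V f c \<subseteq> Pow V"
      by (auto simp: lines_def line_def nsets_def)
  qed
  ultimately show ?thesis by (simp add: card_image)
qed

lemma nat_copy:
  fixes V :: "'a set"
  assumes "finite V" "V \<noteq> {}"
  shows "\<exists>(W :: nat set) f'. finite W \<and> W \<noteq> {} \<and> card W = card V \<and>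
    (\<forall>c. card (lines W f' c) = card (lines V f c))"
proof -
  obtain g :: "'a \<Rightarrow> nat" where g: "inj_on g V"
    using finite_imp_inj_to_nat_seg[OF \<open>finite V\<close>] by blast
  show ?thesis
    using assms card_lines_image[OF g, of f] card_image[OF g]
    by (intro exI[of _ "g ` V"] exI[of _ "\<lambda>T. f (inv_into V g ` T)"]) auto
qed

lemma min_num_lines_le:
  assumes "finite V" "V \<noteq> {}"
  shows "min_num_lines (card V) \<le> num_lines V f"
proof -
  obtain W :: "nat set" and f' where "finite W" "W \<noteq> {}" "card W = card V"
    "\<And>c. card (lines W f' c) = card (lines V f c)"
    using nat_copy[OF assms, of f] by blast
  then show ?thesis
    unfolding min_num_lines_def num_lines_def by (intro Least_le exI[of _ W] exI[of _ f']) simp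
qed

lemma min_prod_lines_le:
  assumes "finite V" "V \<noteq> {}"
  shows "min_prod_lines (card V) \<le> prod_lines V f"
proof -
  obtain W :: "nat set" and f' where "finite W" "W \<noteq> {}" "card W = card V"
    "\<And>c. card (lines W f' c) = card (lines V f c)"
    using nat_copy[OF assms, of f] by blast
  then show ?thesis
    unfolding min_prod_lines_def prod_lines_def by (intro Least_le exI[of _ W] exI[of _ f']) simp
qed

end

theory Submission
  imports Defs
begin

text \<open>
  A red and a blue line with a common generating pair meet exactly in that pair, so the pair is
  determined by its two lines and \<open>n choose 2 \<le> m(R) * m(B)\<close>; part (a) follows by AM-GM.

  In the case of equality every red line \<open>r\<close> and every blue line \<open>b\<close> have a common generating
  pair, so \<open>r \<union> b\<close> is everything and \<open>\<bar>r \<inter> b\<bar> = 2\<close>. Thus lines of the same colour have the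
  same size. Suppose there are two red lines \<open>r \<noteq> r'\<close> and two blue ones. Take \<open>x \<in> r - r'\<close> and
  \<open>x' \<in> r' - r\<close>, and let \<open>b\<close> be the blue line through the pair \<open>{x, x'}\<close>. A point of \<open>b\<close>
  outside another blue line lies on all red lines; on the red line generated by \<open>{x, x'}\<close> it
  can only be \<open>x\<close> or \<open>x'\<close>, but neither of them lies on both \<open>r\<close> and \<open>r'\<close>. So one colour has
  at most one line, and then all triples have that colour.
\<close>

text \<open>Depends on the unordered pair \<open>e\<close> rather than on two ordered generators, so
  that the lines of one colour form the image of \<open>nsets V 2\<close> and counting them is
  counting an image.\<close>

definition pair_line :: "'a set \<Rightarrow> ('a set \<Rightarrow> colour) \<Rightarrow> colour \<Rightarrow> 'a set \<Rightarrow> 'a set" where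
  "pair_line V f c e = e \<union> {p \<in> V - e. f (insert p e) = c}"

lemma line_eq_pair_line:
  assumes "{u, v} \<in> nsets V 2"
  shows "line V f c u v = pair_line V f c {u, v}"
proof -
  have uv: "u \<in> V" "v \<in> V" "u \<noteq> v"
    using assms by (auto simp: nsets_def card_insert_if split: if_splits)
  have "{u, v, p} \<in> nsets V 3 \<longleftrightarrow> p \<in> V - {u, v}" for p
    using uv by (auto simp: nsets_def card_insert_if)
  moreover have "{u, v, p} = insert p {u, v}" for p by blast
  ultimately show ?thesis
    unfolding line_def pair_line_def by simp
qed

lemma lines_eq_image: "lines V f c = pair_line V f c ` nsets V 2"
proof -
  have "lines V f c = {pair_line V f c {u, v} | u v. {u, v} \<in> nsets V 2}"
    unfolding lines_def using line_eq_pair_line by (metis (no_types, lifting))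
  also have "\<dots> = pair_line V f c ` nsets V 2"
    by (auto simp: nsets_def card_2_iff)
  finally show ?thesis .
qed

lemma pair_line_Int: "pair_line V f Red e \<inter> pair_line V f Blue e = e"
  by (auto simp: pair_line_def)

lemma pair_line_Un:
  assumes "e \<subseteq> V"
  shows "pair_line V f Red e \<union> pair_line V f Blue e = V"
  using assms by (auto simp: pair_line_def intro: colour.exhaust)

lemma finite_lines: "finite V \<Longrightarrow> finite (lines V f c)"
  by (simp add: lines_eq_image finite_imp_finite_nsets)

context
  fixes V :: "'a set" and f :: "'a set \<Rightarrow> colour"
  assumes fin: "finite V"
begin

text \<open>The pair is recovered as the intersection of its two lines.\<close>

lemma inj_on_pair_lines: "inj_on (\<lambda>e. (pair_line V f Red e, pair_line V f Blue e)) (nsets V 2)"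
  by (rule inj_onI) (metis pair_line_Int prod.inject)

lemma choose_le_prod_lines: "card V choose 2 \<le> prod_lines V f"
proof -
  have "card (nsets V 2) \<le> card (lines V f Red \<times> lines V f Blue)"
    by (rule card_inj_on_le[OF inj_on_pair_lines])
      (auto simp: lines_eq_image finite_imp_finite_nsets[OF fin])
  then show ?thesis
    by (simp add: prod_lines_def card_cartesian_product)
qed

text \<open>Under equality the injection \<open>?F\<close> maps into a finite set of the same size
  as its domain, so it is onto.\<close>

lemma common_pair_if_eq:
  assumes eq: "prod_lines V f = card V choose 2"
    and "r \<in> lines V f Red" "b \<in> lines V f Blue"
  obtains e where "e \<in> nsets V 2" "r = pair_line V f Red e" "b = pair_line V f Blue e"
proof -
  let ?F = "\<lambda>e. (pair_line V f Red e, pair_line V f Blue e)"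
  have "?F ` nsets V 2 = lines V f Red \<times> lines V f Blue"
  proof (rule card_subset_eq)
    show "finite (lines V f Red \<times> lines V f Blue)"
      using fin by (simp add: finite_lines)
    show "?F ` nsets V 2 \<subseteq> lines V f Red \<times> lines V f Blue"
      by (auto simp: lines_eq_image)
    show "card (?F ` nsets V 2) = card (lines V f Red \<times> lines V f Blue)"
      using eq by (simp add: card_image[OF inj_on_pair_lines] prod_lines_def card_cartesian_product)
  qed
  then have "(r, b) \<in> ?F ` nsets V 2"
    using assms by simp
  then show thesis
    using that by auto
qed

lemma unique_line_if_eq:
  assumes eq: "prod_lines V f = card V choose 2"
  obtains c where "\<And>k l. k \<in> lines V f c \<Longrightarrow> l \<in> lines V f c \<Longrightarrow> k = l"
proof (rule ccontr)
  assume "\<not> thesis"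
  \<comment> \<open>The negated goal says that no colour has at most one line.\<close>
  then have two: "\<exists>k\<in>lines V f c. \<exists>l\<in>lines V f c. k \<noteq> l" for c
    using that by blast
  note pair = common_pair_if_eq[OF eq]
  have Un: "r \<union> b = V" and sub: "r \<subseteq> V" "b \<subseteq> V" and sum: "card r + card b = card V + 2"
    if rb: "r \<in> lines V f Red" "b \<in> lines V f Blue" for r b
  proof -
    obtain e where e: "e \<in> nsets V 2" "r = pair_line V f Red e" "b = pair_line V f Blue e"
      using pair[OF rb] .
    then show Un: "r \<union> b = V"
      using pair_line_Un[of e V f] by (simp add: nsets_def)
    then show "r \<subseteq> V" "b \<subseteq> V" by auto
    then have "finite r" "finite b"
      using fin finite_subset by auto
    moreover have "card (r \<inter> b) = 2"
      using e by (simp add: pair_line_Int nsets_def)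
    ultimately show "card r + card b = card V + 2"
      using card_Un_Int Un by metis
  qed
  have diff: "k - l \<noteq> {}" if "card k = card l" "k \<noteq> l" "l \<subseteq> V" for k l :: "'a set"
    using that fin by (metis Diff_eq_empty_iff card_subset_eq finite_subset)
  obtain r r' where r: "r \<in> lines V f Red" "r' \<in> lines V f Red" "r \<noteq> r'"
    using two by blast
  \<comment> \<open>Any blue line serves here: it is the common partner that forces \<open>r\<close>
    and \<open>r'\<close> to have the same size, so that neither contains the other.\<close>
  obtain b0 where b0: "b0 \<in> lines V f Blue"
    using two by blast
  have "card r = card r'" "r \<subseteq> V" "r' \<subseteq> V"
    using sum[OF r(1) b0] sum[OF r(2) b0] sub(1)[OF r(1) b0] sub(1)[OF r(2) b0] by auto
  then obtain x x' where x: "x \<in> r" "x \<notin> r'" "x' \<in> r'" "x' \<notin> r"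
    using diff[of r r'] diff[of r' r] r(3) by auto
  define e where "e = {x, x'}"
  have e: "e \<in> nsets V 2"
    using x \<open>r \<subseteq> V\<close> \<open>r' \<subseteq> V\<close> by (auto simp: e_def nsets_def card_insert_if)
  define s b where "s = pair_line V f Red e" and "b = pair_line V f Blue e"
  have s: "s \<in> lines V f Red" and b: "b \<in> lines V f Blue"
    using e by (auto simp: s_def b_def lines_eq_image)
  obtain b' where b': "b' \<in> lines V f Blue" "b \<noteq> b'"
    using two by metis
  have "card b = card b'"
    using sum[OF s b] sum[OF s b'(1)] by simp
  then obtain y where y: "y \<in> b" "y \<notin> b'"
    using diff[of b b'] b'(2) sub(2)[OF s b'(1)] by auto
  \<comment> \<open>Every red line \<open>q\<close> covers the complement of \<open>b'\<close>, and
    \<open>y\<close> lies in that complement.\<close>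
  have "y \<in> q" if "q \<in> lines V f Red" for q
    using Un[OF that b'(1)] sub(2)[OF s b] y by auto
  then have "y \<in> s" "y \<in> r" "y \<in> r'"
    using s r by auto
  moreover have "s \<inter> b = e"
    unfolding s_def b_def by (rule pair_line_Int)
  ultimately show False
    using x y(1) by (auto simp: e_def)
qed

end

text \<open>Two pairs inside a triple \<open>{u, v, w}\<close> generate the same line of colour
  \<open>c\<close>. As \<open>w\<close> generates one of them, it lies on the line of
  \<open>{u, v}\<close>, which fixes the colour of the triple.\<close>

lemma monochromatic_if_unique_line:
  assumes uniq: "\<And>k l. k \<in> lines V f c \<Longrightarrow> l \<in> lines V f c \<Longrightarrow> k = l"
    and T: "T \<in> nsets V 3"
  shows "f T = c"
proof -
  obtain u v w where uvw: "T = {u, v, w}" "u \<noteq> v" "u \<noteq> w" "v \<noteq> w"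
    using T by (auto simp: nsets_def card_3_iff)
  then have "{u, v} \<in> nsets V 2" "{u, w} \<in> nsets V 2"
    using T by (auto simp: nsets_def)
  then have "pair_line V f c {u, v} = pair_line V f c {u, w}"
    by (intro uniq) (auto simp: lines_eq_image)
  then have "w \<in> pair_line V f c {u, v}"
    by (auto simp: pair_line_def)
  then have "f (insert w {u, v}) = c"
    using uvw by (simp add: pair_line_def)
  moreover have "insert w {u, v} = T"
    using uvw by blast
  ultimately show ?thesis by simp
qed

text \<open>In colour \<open>c\<close> every pair generates all of \<open>V\<close>; in the other
  colour it generates only itself.\<close>

lemma prod_lines_monochromatic:
  assumes fin: "finite V" and mono: "\<And>T. T \<in> nsets V 3 \<Longrightarrow> f T = c"
  shows "prod_lines V f = card V choose 2"
proof -
  have ins: "insert p e \<in> nsets V 3" if "e \<in> nsets V 2" "p \<in> V - e" for e p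
    using that by (auto simp: nsets_def)
  have same: "pair_line V f c e = V" if "e \<in> nsets V 2" for e
    using that mono[OF ins[OF that]] by (auto simp: pair_line_def nsets_def)
  have other: "pair_line V f d e = e" if "e \<in> nsets V 2" "d \<noteq> c" for d e
    using that mono[OF ins[OF that(1)]] by (auto simp: pair_line_def)
  have card_other: "card (lines V f d) = card V choose 2" if "d \<noteq> c" for d
    using other that by (simp add: lines_eq_image)
  \<comment> \<open>With fewer than two points there are no lines at all, and both sides of the
    claim are 0.\<close>
  have card_same: "card (lines V f c) = (if nsets V 2 = {} then 0 else 1)"
    using same by (simp add: lines_eq_image image_constant_conv)
  have "card V choose 2 = 0" if "nsets V 2 = {}"
    using card_nsets[of V 2] that by simp
  then show ?thesis
    using card_other card_same by (cases c) (auto simp: prod_lines_def)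
qed

lemma prod_lines_eq_choose_iff:
  assumes fin: "finite V"
  shows "prod_lines V f = card V choose 2 \<longleftrightarrow>
    red_triples V f = nsets V 3 \<or> red_triples V f = {}"
proof -
  have "prod_lines V f = card V choose 2 \<longleftrightarrow> (\<exists>c. \<forall>T\<in>nsets V 3. f T = c)"
    using unique_line_if_eq[OF fin] monochromatic_if_unique_line prod_lines_monochromatic[OF fin]
    by metis
  \<comment> \<open>Colour \<open>Red\<close> corresponds to the complete hypergraph,
    \<open>Blue\<close> to the empty one.\<close>
  also have "\<dots> \<longleftrightarrow> red_triples V f = nsets V 3 \<or> red_triples V f = {}"
    unfolding red_triples_def by (auto, metis colour.exhaust)
  finally show ?thesis .
qed

lemma num_lines_ge:
  assumes fin: "finite V"
  shows "2 * sqrt (real (card V choose 2)) \<le> real (num_lines V f)"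
proof -
  let ?a = "real (card (lines V f Red))" and ?b = "real (card (lines V f Blue))"
  have "real (card V choose 2) \<le> ?a * ?b"
    using choose_le_prod_lines[OF fin, of f] unfolding prod_lines_def
    by (metis of_nat_le_iff of_nat_mult)
  then have "sqrt (real (card V choose 2)) \<le> sqrt (?a * ?b)"
    by simp
  also have "\<dots> \<le> (?a + ?b) / 2"
    by (rule arith_geo_mean_sqrt) auto
  finally show ?thesis
    by (simp add: num_lines_def)
qed

theorem theorem1:
  fixes n :: nat
  assumes "n \<ge> 1"
  shows "real (min_num_lines n) \<ge> 2 * sqrt (real (n choose 2)) \<and>
    min_prod_lines n = n choose 2 \<and>
    (\<forall>(V :: 'a set) f. finite V \<and> V \<noteq> {} \<longrightarrow>
      (prod_lines V f = card V choose 2 \<longleftrightarrow>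
        red_triples V f = nsets V 3 \<or> red_triples V f = {}))"
proof (intro conjI)
  show "2 * sqrt (real (n choose 2)) \<le> real (min_num_lines n)"
    using min_num_lines_attained[OF assms] num_lines_ge by metis
  show "min_prod_lines n = n choose 2"
  proof (rule antisym)
    \<comment> \<open>The all-red system on \<open>n\<close> points attains the lower bound.\<close>
    have "prod_lines {..<n} (\<lambda>_. Red) = n choose 2"
      using prod_lines_monochromatic[of "{..<n}" "\<lambda>_. Red" Red] by simp
    then show "min_prod_lines n \<le> n choose 2"
      using min_prod_lines_le[of "{..<n}" "\<lambda>_. Red"] assms by (simp add: lessThan_empty_iff)
    show "n choose 2 \<le> min_prod_lines n"
      using min_prod_lines_attained[OF assms] choose_le_prod_lines by metis
  qed
  show "\<forall>(V :: 'a set) f. finite V \<and> V \<noteq> {} \<longrightarrow>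
      (prod_lines V f = card V choose 2 \<longleftrightarrow>
        red_triples V f = nsets V 3 \<or> red_triples V f = {})"
    using prod_lines_eq_choose_iff by blast
qed

end
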